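(* Let $\bar a=(a_1,a_2,a_3,a_4)$, $\bar p=(p_1,p_2,p_3,p_4)$, $\bar x=(x_1,x_2,x_3,x_4)$, $\bar q=(q_1,q_2,q_3,q_4)$ be complex vectors with $a_ix_ip_iq_i\neq 0$ for $1\le i\le 4$, and put $K:=a_1a_2a_3a_4$, $L:=\sqrt{p_1p_2p_3p_4}$, $K_0:=x_1x_2x_3x_4$, $L_0:=\sqrt{q_1q_2q_3q_4}$. Let $n\ge 0$ be an integer and assume that no denominator below vanishes. Then $$\sum_{k=0}^{n-1}\Gamma_{k-1}[\bar a;\bar p]\,\frac{KL^{k-1}-1}{KL^{k-1}}\prod_{i=1}^4\frac{(a_i^2;p_i)_{k-1}}{(K/a_i^2;L/p_i)_k}\prod_{i=1}^4\frac{(x_i^2;q_i)_k}{(K_0/x_i^2;L_0/q_i)_k}$$ $$=\prod_{i=1}^4\frac{(a_i^2;p_i)_{n-1}}{(K/a_i^2;L/p_i)_{n-1}}\prod_{i=1}^4\frac{(x_i^2;q_i)_n}{(K_0/x_i^2;L_0/q_i)_n}-\prod_{i=1}^4\frac{L/p_i-K/a_i^2}{p_i-a_i^2}$$ $$+\sum_{k=0}^{n-1}\Gamma_k[\bar x;\bar q]\,\frac{1-K_0L_0^k}{K_0L_0^k}\prod_{i=1}^4\frac{(x_i^2;q_i)_k}{(K_0/x_i^2;L_0/q_i)_{k+1}}\prod_{i=1}^4\frac{(a_i^2;p_i)_k}{(K/a_i^2;L/p_i)_k}.$$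
   Context: For a nonzero base $q$ and an integer $m\ge 0$, $(a;q)_m=\prod_{j=0}^{m-1}(1-aq^j)$ and $(a;q)_{-m}=1/\prod_{j=1}^{m}(1-aq^{-j})$; in particular $(a;q)_{-1}=1/(1-a/q)$. For any integer $k$, $$\Gamma_k[\bar x;\bar q]:=\bigl(x_1x_2(q_1q_2)^{k/2}-x_3x_4(q_3q_4)^{k/2}\bigr)\bigl(x_1x_3(q_1q_3)^{k/2}-x_2x_4(q_2q_4)^{k/2}\bigr)\bigl(x_1x_4(q_1q_4)^{k/2}-x_2x_3(q_2q_3)^{k/2}\bigr),$$ and $\Gamma_k[\bar a;\bar p]$ is the same expression with $(x_i,q_i)$ replaced by $(a_i,p_i)$. Square roots are taken consistently: fix a square root $q_i^{1/2}$ of each $q_i$ and $p_i^{1/2}$ of each $p_i$; then $(q_iq_j)^{k/2}=(q_i^{1/2}q_j^{1/2})^k$, $L_0=\prod_i q_i^{1/2}$, and similarly $(p_ip_j)^{k/2}=(p_i^{1/2}p_j^{1/2})^k$, $L=\prod_i p_i^{1/2}$. Empty sums are $0$. *)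

theory Defs
  imports "HOL-Analysis.Analysis"
begin

text \<open>
  The shifted factorial \<open>(a; q)\<^sub>m\<close> for an integer index \<open>m\<close>.  Since \<open>1 / 0 = 0\<close>, for negative \<open>m\<close>
  the inequality \<open>qpoch a q m \<noteq> 0\<close> says exactly that \<open>(a; q)\<^sub>m\<close> is well defined.
\<close>
definition qpoch :: "complex \<Rightarrow> complex \<Rightarrow> int \<Rightarrow> complex" where
  "qpoch a q m =
     (if m \<ge> 0 then \<Prod>j<nat m. 1 - a * q ^ j
      else 1 / (\<Prod>j=1..nat (- m). 1 - a * q powi (- int j)))"

text \<open>
  \<open>\<Gamma>\<^sub>k[x; q]\<close>.  The second argument is the vector \<open>r\<close> of the chosen square roots of the bases,
  \<open>(r $ i)\<^sup>2 = q $ i\<close>, so that \<open>(q\<^sub>i q\<^sub>j)\<close> to the power \<open>k / 2\<close> is \<open>(r $ i * r $ j) powi k\<close>.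
  In the index type \<open>4\<close> the numeral \<open>4\<close> denotes the same element as \<open>0\<close>; the indices
  \<open>1, 2, 3, 4\<close> are distinct and exhaust the type.
\<close>
definition Gam :: "int \<Rightarrow> complex ^ 4 \<Rightarrow> complex ^ 4 \<Rightarrow> complex" where
  "Gam k x r =
     (x$1 * x$2 * (r$1 * r$2) powi k - x$3 * x$4 * (r$3 * r$4) powi k) *
     (x$1 * x$3 * (r$1 * r$3) powi k - x$2 * x$4 * (r$2 * r$4) powi k) *
     (x$1 * x$4 * (r$1 * r$4) powi k - x$2 * x$3 * (r$2 * r$3) powi k)"

end

theory Submission
  imports Defs
begin

text \<open>
  Write \<open>A\<^sub>m\<close> and \<open>B\<^sub>m\<close> for the products of the four quotients of shifted factorials of index \<open>m\<close>
  attached to \<open>(a, p)\<close> and \<open>(x, q)\<close>.  With \<open>y\<^sub>i = a\<^sub>i p\<^sub>i\<^sup>m\<^sup>/\<^sup>2\<close> and \<open>Y = y\<^sub>1 y\<^sub>2 y\<^sub>3 y\<^sub>4\<close>, the polynomial identity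
  \<open>\<Prod>(1 - y\<^sub>i\<^sup>2) - \<Prod>(1 - Y / y\<^sub>i\<^sup>2) = \<Gamma>\<^sub>0[y] (Y - 1) / Y\<close> evaluates the difference \<open>A\<^sub>m\<^sub>+\<^sub>1 - A\<^sub>m\<close>, and likewise
  \<open>B\<^sub>m\<^sub>+\<^sub>1 - B\<^sub>m\<close>.  The theorem is summation by parts for the telescoping sequence \<open>A\<^sub>k\<^sub>-\<^sub>1 B\<^sub>k\<close>.
\<close>

lemma prod_UNIV_4: "prod f (UNIV :: 4 set) = f 1 * f 2 * f 3 * (f 4 :: 'a :: comm_monoid_mult)"
  unfolding UNIV_4 by (simp add: mult.assoc)

text \<open>For m < 0, passing from m to m + 1 cancels the factor 1 - a q^m from a denominator. If
  that factor vanished, the right side would be 0, while the left side could be nonzero.\<close>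

lemma qpoch_add_1:
  assumes "m \<ge> 0 \<or> 1 - a * q powi m \<noteq> 0"
  shows "qpoch a q (m + 1) = qpoch a q m * (1 - a * q powi m)"
proof (cases "m \<ge> 0")
  case True
  then obtain j where "m = int j"
    using nonneg_int_cases by blast
  moreover have "nat (int j + 1) = Suc j"
    by simp
  ultimately show ?thesis
    by (simp add: qpoch_def)
next
  case False
  \<comment> \<open>\<open>j\<close> counts the factors in the denominator for m + 1; the
    denominator for m has one more, namely 1 - a q^m.\<close>
  define j where "j = nat (- m - 1)"
  with False have m: "m = - int (Suc j)"
    by simp
  have "qpoch a q (m + 1) = 1 / (\<Prod>i=1..j. 1 - a * q powi (- int i))"
    using m by (cases j) (auto simp: qpoch_def nat_add_distrib)
  moreover have "qpoch a q m = 1 / ((\<Prod>i=1..j. 1 - a * q powi (- int i)) * (1 - a * q powi m))"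
    unfolding m qpoch_def by (simp add: nat_add_distrib)
  moreover have "1 - a * q powi m \<noteq> 0"
    using assms False by simp
  ultimately show ?thesis
    by (simp only: times_divide_eq_left mult_1_left nonzero_divide_mult_cancel_right not_False_eq_True)
qed

text \<open>If the last factor vanishes and \<open>m < 0\<close>, both sides are \<open>0\<close> because \<open>1 / 0 = 0\<close>.\<close>
lemma inverse_qpoch_add_1:
  assumes "qpoch a q (m + 1) \<noteq> 0"
  shows "1 / qpoch a q m = (1 - a * q powi m) / qpoch a q (m + 1)"
proof (cases "1 - a * q powi m = 0")
  case False
  then show ?thesis
    using qpoch_add_1[of m a q] by simp
next
  case True
  then have "m < 0"
    using assms qpoch_add_1[of m a q] by fastforce
  moreover have "(\<Prod>j=1..nat (- m). 1 - a * q powi (- int j)) = 0"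
    using True \<open>m < 0\<close> by (intro prod_zero bexI[of _ "nat (- m)"]) auto
  ultimately have "qpoch a q m = 0"
    by (simp add: qpoch_def)
  with True show ?thesis
    by simp
qed

text \<open>Since 1 - Y / u^2 = (u - v w z) / u, and similarly for v, w, z, multiplying by Y = u v w
  z leaves a polynomial identity in four free variables.\<close>

lemma four_term_identity:
  fixes u v w z :: complex
  assumes "u * v * w * z = Y" "Y \<noteq> 0"
  shows "(u * v - w * z) * (u * w - v * z) * (u * z - v * w) * ((Y - 1) / Y) =
    (1 - u\<^sup>2) * (1 - v\<^sup>2) * (1 - w\<^sup>2) * (1 - z\<^sup>2)
    - (1 - Y / u\<^sup>2) * (1 - Y / v\<^sup>2) * (1 - Y / w\<^sup>2) * (1 - Y / z\<^sup>2)"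
proof -
  have nz: "u \<noteq> 0" "v \<noteq> 0" "w \<noteq> 0" "z \<noteq> 0"
    using assms by auto
  have q: "1 - Y / u\<^sup>2 = (u - v * w * z) / u" "1 - Y / v\<^sup>2 = (v - u * w * z) / v"
    "1 - Y / w\<^sup>2 = (w - u * v * z) / w" "1 - Y / z\<^sup>2 = (z - u * v * w) / z"
    unfolding assms(1)[symmetric] using nz by (simp_all add: field_simps power2_eq_square)
  have "(u * v - w * z) * (u * w - v * z) * (u * z - v * w) * (u * v * w * z - 1) =
      (1 - u\<^sup>2) * (1 - v\<^sup>2) * (1 - w\<^sup>2) * (1 - z\<^sup>2) * (u * v * w * z)
      - (u - v * w * z) * (v - u * w * z) * (w - u * v * z) * (z - u * v * w)"
    by algebra
  then have "(u * v - w * z) * (u * w - v * z) * (u * z - v * w) * (Y - 1) =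
      (1 - u\<^sup>2) * (1 - v\<^sup>2) * (1 - w\<^sup>2) * (1 - z\<^sup>2) * Y
      - (u - v * w * z) * (v - u * w * z) * (w - u * v * z) * (z - u * v * w)"
    unfolding assms(1) .
  then have "(u * v - w * z) * (u * w - v * z) * (u * z - v * w) * (Y - 1) / Y =
      (1 - u\<^sup>2) * (1 - v\<^sup>2) * (1 - w\<^sup>2) * (1 - z\<^sup>2)
      - (u - v * w * z) * (v - u * w * z) * (w - u * v * z) * (z - u * v * w) / Y"
    using assms(2) by (simp only: diff_divide_distrib nonzero_mult_div_cancel_right not_False_eq_True)
  moreover have "(1 - Y / u\<^sup>2) * (1 - Y / v\<^sup>2) * (1 - Y / w\<^sup>2) * (1 - Y / z\<^sup>2) =
      (u - v * w * z) * (v - u * w * z) * (w - u * v * z) * (z - u * v * w) / Y"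
    unfolding q times_divide_times_eq assms(1) ..
  ultimately show ?thesis
    by (simp only: times_divide_eq_right)
qed

text \<open>The index is an integer because the telescoping starts from m = -1.\<close>

definition qquot :: "complex ^ 4 \<Rightarrow> complex ^ 4 \<Rightarrow> complex \<Rightarrow> complex \<Rightarrow> int \<Rightarrow> complex" where
  "qquot a p K L m =
     (\<Prod>i\<in>UNIV. qpoch ((a$i)\<^sup>2) (p$i) m / qpoch (K / (a$i)\<^sup>2) (L / p$i) m)"

text \<open>The product with numerators at m and denominators at m + 1 divides both terms on the
  right: the first has the extra factors 1 - y_i^2, the second 1 - Y / y_i^2, and
  \<open>four_term_identity\<close> gives the difference of these cofactors.\<close>

lemma qquot_diff:
  fixes a p r :: "complex ^ 4"
  assumes nz: "\<And>i. a$i \<noteq> 0" "\<And>i. p$i \<noteq> 0"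
    and r: "\<And>i. (r$i)\<^sup>2 = p$i"
    and K: "K = a$1 * a$2 * a$3 * a$4"
    and L: "L = r$1 * r$2 * r$3 * r$4"
    and num: "\<And>i. m \<ge> 0 \<or> 1 - (a$i)\<^sup>2 * p$i powi m \<noteq> 0"
    and den: "\<And>i. qpoch (K / (a$i)\<^sup>2) (L / p$i) (m + 1) \<noteq> 0"
  shows "Gam m a r * ((K * L powi m - 1) / (K * L powi m))
      * (\<Prod>i\<in>UNIV. qpoch ((a$i)\<^sup>2) (p$i) m / qpoch (K / (a$i)\<^sup>2) (L / p$i) (m + 1))
    = qquot a p K L (m + 1) - qquot a p K L m"
proof -
  \<comment> \<open>The chosen roots give y_i^2 = a_i^2 p_i^m, and since L is the product of the
    r_i, the product of the y_i is K L^m.\<close>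
  define y where "y i = a$i * r$i powi m" for i
  define Y where "Y = K * L powi m"
  define c where "c i = qpoch ((a$i)\<^sup>2) (p$i) m / qpoch (K / (a$i)\<^sup>2) (L / p$i) (m + 1)" for i
  have rnz: "r$i \<noteq> 0" for i
    using r[of i] nz(2)[of i] by auto
  have Y: "y 1 * y 2 * y 3 * y 4 = Y"
    unfolding y_def Y_def K L by (simp add: power_int_mult_distrib mult_ac)
  have Y0: "Y \<noteq> 0"
    unfolding Y[symmetric] y_def using nz(1) rnz by simp
  have y2: "(a$i)\<^sup>2 * p$i powi m = (y i)\<^sup>2" for i
    unfolding y_def r[symmetric] by (simp add: power_mult_distrib power_int_mult_distrib power2_eq_square)
  have Yy2: "K / (a$i)\<^sup>2 * (L / p$i) powi m = Y / (y i)\<^sup>2" for i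
    unfolding y2[symmetric] Y_def by (simp add: power_int_divide_distrib)
  have G: "Gam m a r = (y 1 * y 2 - y 3 * y 4) * (y 1 * y 3 - y 2 * y 4) * (y 1 * y 4 - y 2 * y 3)"
    unfolding Gam_def y_def by (simp add: power_int_mult_distrib mult_ac)
  have "qpoch ((a$i)\<^sup>2) (p$i) (m + 1) / qpoch (K / (a$i)\<^sup>2) (L / p$i) (m + 1) = c i * (1 - (y i)\<^sup>2)" for i
    unfolding c_def using qpoch_add_1[OF num[of i]] by (simp add: y2)
  then have 1: "qquot a p K L (m + 1) = (\<Prod>i\<in>UNIV. c i) * (\<Prod>i\<in>UNIV. 1 - (y i)\<^sup>2)"
    by (simp add: qquot_def prod.distrib)
  have "qpoch ((a$i)\<^sup>2) (p$i) m / qpoch (K / (a$i)\<^sup>2) (L / p$i) m = c i * (1 - Y / (y i)\<^sup>2)" for i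
    using arg_cong[OF inverse_qpoch_add_1[OF den[of i]], of "\<lambda>t. qpoch ((a$i)\<^sup>2) (p$i) m * t"]
    unfolding Yy2 c_def by simp
  then have 2: "qquot a p K L m = (\<Prod>i\<in>UNIV. c i) * (\<Prod>i\<in>UNIV. 1 - Y / (y i)\<^sup>2)"
    by (simp add: qquot_def prod.distrib)
  have "Gam m a r * ((Y - 1) / Y) = (\<Prod>i\<in>UNIV. 1 - (y i)\<^sup>2) - (\<Prod>i\<in>UNIV. 1 - Y / (y i)\<^sup>2)"
    unfolding G prod_UNIV_4 by (rule four_term_identity[OF Y Y0])
  then show ?thesis
    unfolding 1 2 Y_def[symmetric] c_def[symmetric] by (subst mult.commute) (simp only: right_diff_distrib[symmetric])
qed

theorem theorem2p1:
  fixes a p x q rp rq :: "complex ^ 4"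
    and K L K0 L0 :: complex
    and n :: nat
  assumes nonzero: "\<forall>i. a$i * x$i * p$i * q$i \<noteq> 0"
    and sqrt_p: "\<forall>i. (rp$i)^2 = p$i"
    and sqrt_q: "\<forall>i. (rq$i)^2 = q$i"
    and K: "K = a$1 * a$2 * a$3 * a$4"
    and L: "L = rp$1 * rp$2 * rp$3 * rp$4"
    and K0: "K0 = x$1 * x$2 * x$3 * x$4"
    and L0: "L0 = rq$1 * rq$2 * rq$3 * rq$4"
    and denom_pa: "\<forall>i. p$i - (a$i)^2 \<noteq> 0"
    and denom_a: "\<forall>i. \<forall>k<n. qpoch (K / (a$i)^2) (L / p$i) (int k) \<noteq> 0"
    and denom_a': "\<forall>i. qpoch (K / (a$i)^2) (L / p$i) (int n - 1) \<noteq> 0"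
    and denom_x: "\<forall>i. \<forall>k\<le>n. qpoch (K0 / (x$i)^2) (L0 / q$i) (int k) \<noteq> 0"
  shows
    "(\<Sum>k<n. Gam (int k - 1) a rp
        * ((K * L powi (int k - 1) - 1) / (K * L powi (int k - 1)))
        * (\<Prod>i\<in>UNIV. qpoch ((a$i)^2) (p$i) (int k - 1) / qpoch (K / (a$i)^2) (L / p$i) (int k))
        * (\<Prod>i\<in>UNIV. qpoch ((x$i)^2) (q$i) (int k) / qpoch (K0 / (x$i)^2) (L0 / q$i) (int k)))
     = (\<Prod>i\<in>UNIV. qpoch ((a$i)^2) (p$i) (int n - 1) / qpoch (K / (a$i)^2) (L / p$i) (int n - 1))
        * (\<Prod>i\<in>UNIV. qpoch ((x$i)^2) (q$i) (int n) / qpoch (K0 / (x$i)^2) (L0 / q$i) (int n))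
       - (\<Prod>i\<in>UNIV. (L / p$i - K / (a$i)^2) / (p$i - (a$i)^2))
       + (\<Sum>k<n. Gam (int k) x rq
        * ((1 - K0 * L0 ^ k) / (K0 * L0 ^ k))
        * (\<Prod>i\<in>UNIV. qpoch ((x$i)^2) (q$i) (int k) / qpoch (K0 / (x$i)^2) (L0 / q$i) (int k + 1))
        * (\<Prod>i\<in>UNIV. qpoch ((a$i)^2) (p$i) (int k) / qpoch (K / (a$i)^2) (L / p$i) (int k)))"
proof -
  have nz: "a$i \<noteq> 0" "x$i \<noteq> 0" "p$i \<noteq> 0" "q$i \<noteq> 0" for i
    using nonzero[rule_format, of i] by auto
  define A where "A = qquot a p K L"
  define B where "B = qquot x q K0 L0"
  have dA: "Gam (int k - 1) a rp
        * ((K * L powi (int k - 1) - 1) / (K * L powi (int k - 1)))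
        * (\<Prod>i\<in>UNIV. qpoch ((a$i)^2) (p$i) (int k - 1) / qpoch (K / (a$i)^2) (L / p$i) (int k))
      = A (int k) - A (int k - 1)" if "k < n" for k
  proof -
    \<comment> \<open>Only k = 0 gives a negative index; there the factor is 1 - a_i^2 / p_i,
      nonzero by \<open>denom_pa\<close>.\<close>
    have "int k - 1 \<ge> 0 \<or> 1 - (a$i)\<^sup>2 * p$i powi (int k - 1) \<noteq> 0" for i
      using denom_pa[rule_format, of i] nz(3)[of i] by (cases k) (auto simp: field_simps)
    moreover have "qpoch (K / (a$i)\<^sup>2) (L / p$i) (int k - 1 + 1) \<noteq> 0" for i
      using denom_a that by simp
    ultimately show ?thesis
      using qquot_diff[OF nz(1,3) sqrt_p[rule_format] K L, of "int k - 1"] by (simp add: A_def)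
  qed
  have dB: "Gam (int k) x rq
        * ((1 - K0 * L0 ^ k) / (K0 * L0 ^ k))
        * (\<Prod>i\<in>UNIV. qpoch ((x$i)^2) (q$i) (int k) / qpoch (K0 / (x$i)^2) (L0 / q$i) (int k + 1))
      = B (int k) - B (int k + 1)" if "k < n" for k
  proof -
    have "qpoch (K0 / (x$i)\<^sup>2) (L0 / q$i) (int k + 1) \<noteq> 0" for i
      using denom_x[rule_format, of "Suc k" i] that by (simp add: add.commute)
    then have "Gam (int k) x rq * ((K0 * L0 ^ k - 1) / (K0 * L0 ^ k))
        * (\<Prod>i\<in>UNIV. qpoch ((x$i)^2) (q$i) (int k) / qpoch (K0 / (x$i)^2) (L0 / q$i) (int k + 1))
      = B (int k + 1) - B (int k)"
      using qquot_diff[OF nz(2,4) sqrt_q[rule_format] K0 L0, of "int k"] by (simp add: B_def)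
    \<comment> \<open>The second sum carries the opposite sign, so its terms are B_k -
      B_{k+1}.\<close>
    moreover have "(1 - K0 * L0 ^ k) / (K0 * L0 ^ k) = - ((K0 * L0 ^ k - 1) / (K0 * L0 ^ k))"
      by (metis minus_diff_eq minus_divide_left)
    ultimately show ?thesis
      by simp
  qed
  have B0: "B 0 = 1"
    by (simp add: B_def qquot_def qpoch_def)
  have A_minus_1: "A (- 1) = (\<Prod>i\<in>UNIV. (L / p$i - K / (a$i)^2) / (p$i - (a$i)^2))"
  proof -
    have rp0: "rp$i \<noteq> 0" for i
      using sqrt_p[rule_format, of i] nz(3)[of i] by auto
    then have L0: "L \<noteq> 0"
      by (simp add: L)
    have "L\<^sup>2 = (\<Prod>i\<in>UNIV. p$i)"
      unfolding L prod_UNIV_4 sqrt_p[rule_format, symmetric] by (simp add: power_mult_distrib)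
    \<comment> \<open>Each factor of A_{-1} equals the desired one times p_i^2 / L. These four
      corrections multiply to 1, because L^4 is the square of the product of the p_i.\<close>
    moreover have "(\<Prod>i\<in>UNIV. (p$i)\<^sup>2 / L) = ((\<Prod>i\<in>UNIV. p$i) / L\<^sup>2)\<^sup>2"
      unfolding prod_UNIV_4 by (simp add: power2_eq_square mult_ac)
    ultimately have c: "(\<Prod>i\<in>UNIV. (p$i)\<^sup>2 / L) = 1"
      using L0 nz(3) by simp
    have "qpoch ((a$i)\<^sup>2) (p$i) (- 1) / qpoch (K / (a$i)\<^sup>2) (L / p$i) (- 1)
        = (L / p$i - K / (a$i)^2) / (p$i - (a$i)^2) * ((p$i)\<^sup>2 / L)" for i
    proof -
      have "1 - K / (a$i)\<^sup>2 / (L / p$i) = (L / p$i - K / (a$i)\<^sup>2) * (p$i / L)"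
        using nz(3)[of i] L0 by (simp add: left_diff_distrib diff_divide_distrib)
      moreover have "1 - (a$i)\<^sup>2 / p$i = (p$i - (a$i)\<^sup>2) / p$i"
        using nz(3)[of i] by (simp add: diff_divide_distrib)
      moreover have "qpoch b s (- 1) = 1 / (1 - b / s)" for b s :: complex
        by (simp add: qpoch_def divide_inverse)
      ultimately show ?thesis
        by (simp add: power2_eq_square)
    qed
    then have "A (- 1) = (\<Prod>i\<in>UNIV. (L / p$i - K / (a$i)^2) / (p$i - (a$i)^2)) * (\<Prod>i\<in>UNIV. (p$i)\<^sup>2 / L)"
      unfolding A_def qquot_def prod.distrib[symmetric] by simp
    with c show ?thesis
      by simp
  qed
  \<comment> \<open>The induction step is A_k B_{k+1} - A_{k-1} B_k = (A_k - A_{k-1}) B_k + (B_{k+1}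
    - B_k) A_k; the lower boundary term is A_{-1} B_0.\<close>
  have parts: "(\<Sum>k<n. (A (int k) - A (int k - 1)) * B (int k))
      = A (int n - 1) * B (int n) - A (- 1) * B 0
        + (\<Sum>k<n. (B (int k) - B (int k + 1)) * A (int k))"
    by (induction n) (simp_all add: algebra_simps)
  have A_eq: "(\<Prod>i\<in>UNIV. qpoch ((a$i)^2) (p$i) m / qpoch (K / (a$i)^2) (L / p$i) m) = A m"
    and B_eq: "(\<Prod>i\<in>UNIV. qpoch ((x$i)^2) (q$i) m / qpoch (K0 / (x$i)^2) (L0 / q$i) m) = B m" for m
    by (simp_all add: A_def B_def qquot_def)
  show ?thesis
    unfolding A_eq B_eq A_minus_1[symmetric]
    using parts[unfolded B0 mult_1_right]
    \<comment> \<open>\<open>dA\<close> and \<open>dB\<close> hold only for k < n, so their premise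
      is restated as membership in the range, which \<open>sum.cong\<close> supplies.\<close>
    by (simp only: dA[OF iffD1[OF lessThan_iff]] dB[OF iffD1[OF lessThan_iff]] cong: sum.cong)
qed

end
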